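(* Let $\mathcal P$ be a reversible ergodic Markov chain on a finite state space $\Omega$ with stationary distribution $\pi$, let $\mathcal W$ be its qubitized Szegedy walk with phase gap $\Delta_{\mathcal W}$, let $\Pi_0$ be the orthogonal projector onto $\ker(\mathcal W-\mathbb I)$, and let $\Pi_\pi:=|\pi\rangle\langle\pi|$. Let $\varepsilon^{\mathcal W}\in(0,1)$, $\phi\in\mathbb R$, let $\mathcal C:=\mathcal C_{\Delta_{\mathcal W},\varepsilon^{\mathcal W}}(\mathcal W)$ be the projector circuit described in the context, using $d$ controlled-$\mathcal W$ operators, and define $$\widetilde{\mathcal S}_\phi(\Pi_0):=(\mathbb I_s\otimes O_{\mathcal P}^\dagger)\,\mathcal C^\dagger\,(P_\phi\otimes\mathbb I_{AB})\,\mathcal C\,(\mathbb I_s\otimes O_{\mathcal P}).$$ Then $$\bigl\|\widetilde{\mathcal S}_\phi(\Pi_0)\,\mathcal J-\mathcal J\,\mathcal S_\phi(\Pi_\pi)\bigr\|\le 2\varepsilon^{\mathcal W},$$ and $\widetilde{\mathcal S}_\phi(\Pi_0)$ uses $4d+2$ queries to the oracle and one signal qubit.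
   Context: $\|\cdot\|$ is the operator norm. Registers $A,B$ (each of $\lceil\log_2|\Omega|\rceil$ qubits) have state spaces $\mathcal H_A,\mathcal H_B$ with basis indexed by $\Omega$, $|0\rangle_B$ is the all-zeros reference basis state of $B$, and $\mathcal H_s\cong\mathbb C^2$ is the signal qubit. $P$ denotes the transition matrix of $\mathcal P$ and $|\pi\rangle:=\sum_x\sqrt{\pi(x)}|x\rangle\in\mathcal H_A$. The step isometry $\mathcal T:\mathcal H_A\to\mathcal H_A\otimes\mathcal H_B$ is $\mathcal T|x\rangle:=|x\rangle\sum_y\sqrt{P(x,y)}|y\rangle$, the swap is $S|x\rangle|y\rangle:=|y\rangle|x\rangle$, and $\mathcal W:=(2\mathcal T\mathcal T^\dagger-\mathbb I)S$. The phase gap is $\Delta_{\mathcal W}:=\min\{|\theta|:\theta\ne0,\ e^{i\theta}\in\mathrm{spec}(\mathcal W),\ \theta\in(-\pi,\pi]\}$. The oracle $O_{\mathcal P}$ is a unitary on $\mathcal H_A\otimes\mathcal H_B$ with $O_{\mathcal P}|x\rangle|0\rangle=\sum_y\sqrt{P(x,y)}|x\rangle|y\rangle$ for all $x$; a query is a use of $O_{\mathcal P}$ or $O_{\mathcal P}^\dagger$. One application of (controlled-)$\mathcal W$ or its adjoint is implemented through $\mathcal W=\bigl[O_{\mathcal P}(\mathbb I\otimes(2|0\rangle\langle0|-\mathbb I))O_{\mathcal P}^\dagger\bigr]S$ and uses two queries. The embedding $\mathcal J:\mathcal H_A\to\mathcal H_s\otimes\mathcal H_A\otimes\mathcal H_B$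 is $\mathcal J|v\rangle:=|0\rangle_s|v\rangle_A|0\rangle_B$. For an orthogonal projector $\Pi$, $\mathcal S_\phi(\Pi):=\mathbb I+(e^{i\phi}-1)\Pi$. $P_\phi:=e^{i\phi}|0\rangle\langle0|+|1\rangle\langle1|$ acts on the signal qubit. Projector circuit: $\mathcal C_{\Delta_{\mathcal W},\varepsilon^{\mathcal W}}(\mathcal W)$ is the generalized-quantum-signal-processing unitary on $\mathcal H_s\otimes\mathcal H_A\otimes\mathcal H_B$ composed of $d$ controlled-$\mathcal W$ operators (controlled on the signal qubit), interleaved with single-qubit gates on the signal qubit, and satisfying $$\mathcal C_{\Delta_{\mathcal W},\varepsilon^{\mathcal W}}(\mathcal W)(|0\rangle_s\otimes\mathbb I_{AB})=|0\rangle_s\otimes\Upsilon(\mathcal W)+|1\rangle_s\otimes\Phi(\mathcal W),$$ where $\Upsilon,\Phi\in\mathbb C[x]$ are polynomials of degree $d$, $\Upsilon(1)=1$, $|\Upsilon(e^{i\theta})|\le\varepsilon^{\mathcal W}$ for every eigenvalue $e^{i\theta}\ne1$ of $\mathcal W$ (hence $\|\Upsilon(\mathcal W)-\Pi_0\|\le\varepsilon^{\mathcal W}$), and $\Upsilon(\mathcal W)^\dagger\Upsilon(\mathcal W)+\Phi(\mathcal W)^\dagger\Phi(\mathcal W)=\mathbb I$. *)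

theory Defs
  imports "HOL-Analysis.Analysis" "HOL-Computational_Algebra.Polynomial"
begin

text \<open>
  Vectors and operators live on finite index types: \<open>complex ^ 'a\<close> has the orthonormal basis
  \<open>|i\<rangle> = axis i 1\<close> with \<open>i :: 'a\<close>, and tensor products are indexed by product types.  An operator
  from \<open>complex ^ 'n\<close> to \<open>complex ^ 'm\<close> is a matrix of type \<open>complex ^ 'n ^ 'm\<close> (rows \<open>'m\<close>,
  columns \<open>'n\<close>).
\<close>

abbreviation ket :: "'a::finite \<Rightarrow> complex ^ 'a" where
  "ket i \<equiv> axis i 1"

definition vtensor :: "complex ^ 'a \<Rightarrow> complex ^ 'b \<Rightarrow> complex ^ ('a::finite \<times> 'b::finite)"
    (infixr "\<otimes>v" 75) where
  "u \<otimes>v w = (\<chi> p. u $ fst p * w $ snd p)"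

definition mtensor :: "complex ^ 'a ^ 'c \<Rightarrow> complex ^ 'b ^ 'd
    \<Rightarrow> complex ^ ('a::finite \<times> 'b::finite) ^ ('c::finite \<times> 'd::finite)"
    (infixr "\<otimes>m" 75) where
  "A \<otimes>m B = (\<chi> p q. A $ fst p $ fst q * B $ snd p $ snd q)"

definition dagger :: "complex ^ 'n ^ 'm \<Rightarrow> complex ^ 'm ^ 'n" where
  "dagger A = map_matrix cnj (transpose A)"

definition unitary :: "complex ^ 'n ^ 'n \<Rightarrow> bool" where
  "unitary U \<longleftrightarrow> dagger U ** U = mat 1 \<and> U ** dagger U = mat 1"

definition cscale :: "complex \<Rightarrow> complex ^ 'n ^ 'm \<Rightarrow> complex ^ 'n ^ 'm" (infixr "*m" 75) where
  "c *m A = map_matrix ((*) c) A"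

definition outer :: "complex ^ 'm \<Rightarrow> complex ^ 'n \<Rightarrow> complex ^ 'n ^ 'm" where
  "outer u v = (\<chi> i j. u $ i * cnj (v $ j))"

definition op_norm :: "complex ^ 'n ^ 'm \<Rightarrow> real" where
  "op_norm A = onorm ((*v) A)"

primrec mat_pow :: "'k::semiring_1 ^ 'n ^ 'n \<Rightarrow> nat \<Rightarrow> 'k ^ 'n ^ 'n" where
  "mat_pow A 0 = mat 1"
| "mat_pow A (Suc k) = A ** mat_pow A k"

definition mat_poly :: "complex poly \<Rightarrow> complex ^ 'n ^ 'n \<Rightarrow> complex ^ 'n ^ 'n" where
  "mat_poly p A = (\<Sum>k\<le>degree p. coeff p k *m mat_pow A k)"

definition spec :: "complex ^ 'n ^ 'n \<Rightarrow> complex set" where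
  "spec A = {l. \<exists>v. v \<noteq> 0 \<and> A *v v = l *s v}"

definition is_orth_proj_onto :: "complex ^ 'n ^ 'n \<Rightarrow> (complex ^ 'n) set \<Rightarrow> bool" where
  "is_orth_proj_onto Q V \<longleftrightarrow> Q ** Q = Q \<and> dagger Q = Q \<and> range ((*v) Q) = V"

definition stochastic :: "real ^ 's ^ 's \<Rightarrow> bool" where
  "stochastic P \<longleftrightarrow> (\<forall>x y. 0 \<le> P $ x $ y) \<and> (\<forall>x. (\<Sum>y\<in>UNIV. P $ x $ y) = 1)"

definition ergodic :: "real ^ 's ^ 's \<Rightarrow> bool" where
  "ergodic P \<longleftrightarrow>
     (\<forall>x y. \<exists>t. 0 < mat_pow P t $ x $ y) \<and>
     (\<forall>x. Gcd {t. 0 < t \<and> 0 < mat_pow P t $ x $ x} = 1)"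

definition stationary :: "real ^ 's ^ 's \<Rightarrow> real ^ 's \<Rightarrow> bool" where
  "stationary P \<pi> \<longleftrightarrow> (\<forall>x. 0 \<le> \<pi> $ x) \<and> (\<Sum>x\<in>UNIV. \<pi> $ x) = 1 \<and> \<pi> v* P = \<pi>"

definition reversible :: "real ^ 's ^ 's \<Rightarrow> real ^ 's \<Rightarrow> bool" where
  "reversible P \<pi> \<longleftrightarrow> (\<forall>x y. \<pi> $ x * P $ x $ y = \<pi> $ y * P $ y $ x)"

definition stat_ket :: "real ^ 's \<Rightarrow> complex ^ 's" where
  "stat_ket \<pi> = (\<chi> x. complex_of_real (sqrt (\<pi> $ x)))"

definition row_ket :: "real ^ 's ^ 's \<Rightarrow> 's::finite \<Rightarrow> complex ^ 's" where
  "row_ket P x = (\<chi> y. complex_of_real (sqrt (P $ x $ y)))"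

definition step_iso :: "real ^ 's ^ 's \<Rightarrow> complex ^ 's ^ ('s::finite \<times> 's)" where
  "step_iso P = (\<chi> p x. (ket x \<otimes>v row_ket P x) $ p)"

definition swap_op :: "complex ^ ('s \<times> 's) ^ ('s::finite \<times> 's)" where
  "swap_op = (\<chi> p q. (ket (snd q) \<otimes>v ket (fst q)) $ p)"

definition walk :: "real ^ 's ^ 's \<Rightarrow> complex ^ ('s \<times> 's) ^ ('s::finite \<times> 's)" where
  "walk P = (2 *m (step_iso P ** dagger (step_iso P)) - mat 1) ** swap_op"

definition phase_gap :: "complex ^ 'n ^ 'n \<Rightarrow> real" where
  "phase_gap W = Min {\<bar>\<theta>\<bar> |\<theta>. \<theta> \<noteq> 0 \<and> cis \<theta> \<in> spec W \<and> - pi < \<theta> \<and> \<theta> \<le> pi}"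

text \<open>The element \<open>z\<close> of the state space labels the all-zeros reference state of register \<open>B\<close>.\<close>

definition is_oracle ::
    "real ^ 's ^ 's \<Rightarrow> 's::finite \<Rightarrow> complex ^ ('s \<times> 's) ^ ('s \<times> 's) \<Rightarrow> bool" where
  "is_oracle P z U \<longleftrightarrow>
     unitary U \<and> (\<forall>x. U *v (ket x \<otimes>v ket z) = ket x \<otimes>v row_ket P x)"

text \<open>The signal qubit has basis \<open>|0\<rangle> = ket False\<close>, \<open>|1\<rangle> = ket True\<close>.\<close>

definition signal_embed :: "'s::finite \<Rightarrow> complex ^ 's ^ (bool \<times> 's \<times> 's)" where
  "signal_embed z = matrix (\<lambda>v. ket False \<otimes>v v \<otimes>v ket z)"

definition ket_tensor :: "bool \<Rightarrow> complex ^ 'n ^ 'n \<Rightarrow> complex ^ 'n ^ (bool \<times> 'n::finite)" where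
  "ket_tensor b A = matrix (\<lambda>v. ket b \<otimes>v (A *v v))"

definition ctrl :: "complex ^ 'n ^ 'n \<Rightarrow> complex ^ (bool \<times> 'n) ^ (bool \<times> 'n::finite)" where
  "ctrl U = outer (ket False) (ket False) \<otimes>m mat 1 + outer (ket True) (ket True) \<otimes>m U"

definition phase_rot :: "real \<Rightarrow> complex ^ 'n ^ 'n \<Rightarrow> complex ^ 'n ^ 'n" where
  "phase_rot \<phi> Q = mat 1 + (cis \<phi> - 1) *m Q"

definition signal_phase :: "real \<Rightarrow> complex ^ bool ^ bool" where
  "signal_phase \<phi> = cis \<phi> *m outer (ket False) (ket False) + outer (ket True) (ket True)"

text \<open>
  Generalized quantum signal processing with single-qubit gates \<open>R 0, \<dots>, R d\<close>.  Controlling on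
  \<open>|0\<rangle>\<close> instead of \<open>|1\<rangle>\<close> gives the same family of operators, since the bit flips are absorbed by
  the gates \<open>R i\<close>.
\<close>

primrec gqsp :: "complex ^ 'n ^ 'n \<Rightarrow> (nat \<Rightarrow> complex ^ bool ^ bool) \<Rightarrow> nat
    \<Rightarrow> complex ^ (bool \<times> 'n) ^ (bool \<times> 'n::finite)" where
  "gqsp W R 0 = R 0 \<otimes>m mat 1"
| "gqsp W R (Suc d) = (R (Suc d) \<otimes>m mat 1) ** ctrl W ** gqsp W R d"

definition projector_circuit :: "complex ^ 'n ^ 'n \<Rightarrow> real \<Rightarrow> nat
    \<Rightarrow> (nat \<Rightarrow> complex ^ bool ^ bool) \<Rightarrow> complex poly \<Rightarrow> complex poly \<Rightarrow> bool" where
  "projector_circuit W \<epsilon> d R \<Upsilon> \<Phi> \<longleftrightarrow>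
     (\<forall>i\<le>d. unitary (R i)) \<and>
     gqsp W R d ** ket_tensor False (mat 1)
       = ket_tensor False (mat_poly \<Upsilon> W) + ket_tensor True (mat_poly \<Phi> W) \<and>
     degree \<Upsilon> = d \<and> degree \<Phi> = d \<and>
     poly \<Upsilon> 1 = 1 \<and>
     (\<forall>\<theta>. cis \<theta> \<in> spec W \<and> cis \<theta> \<noteq> 1 \<longrightarrow> cmod (poly \<Upsilon> (cis \<theta>)) \<le> \<epsilon>) \<and>
     dagger (mat_poly \<Upsilon> W) ** mat_poly \<Upsilon> W + dagger (mat_poly \<Phi> W) ** mat_poly \<Phi> W = mat 1"

definition approx_rot :: "complex ^ ('s \<times> 's) ^ ('s \<times> 's)
    \<Rightarrow> complex ^ (bool \<times> 's \<times> 's) ^ (bool \<times> 's \<times> 's) \<Rightarrow> real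
    \<Rightarrow> complex ^ (bool \<times> 's \<times> 's) ^ (bool \<times> 's \<times> 's::finite)" where
  "approx_rot U C \<phi> =
     (mat 1 \<otimes>m dagger U) ** dagger C ** (signal_phase \<phi> \<otimes>m mat 1) ** C ** (mat 1 \<otimes>m U)"

text \<open>
  Circuits are lists of gates in order of application.  The only gates depending on the Markov
  chain are \<open>Query\<close> and \<open>QueryAdj\<close>.  In the controlled walk the control is put on the swap and on
  the reflection \<open>2|0\<rangle>\<langle>0| - I\<close> only; the two oracle calls cancel when the control is off.
\<close>

datatype gate =
    Query
  | QueryAdj
  | SignalGate "complex ^ bool ^ bool"
  | CtrlSwap
  | CtrlReflect

primrec gate_op :: "complex ^ ('s \<times> 's) ^ ('s \<times> 's) \<Rightarrow> 's \<Rightarrow> gate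
    \<Rightarrow> complex ^ (bool \<times> 's \<times> 's) ^ (bool \<times> 's \<times> 's::finite)" where
  "gate_op U z Query = mat 1 \<otimes>m U"
| "gate_op U z QueryAdj = mat 1 \<otimes>m dagger U"
| "gate_op U z (SignalGate R) = R \<otimes>m mat 1"
| "gate_op U z CtrlSwap = ctrl swap_op"
| "gate_op U z CtrlReflect = ctrl (mat 1 \<otimes>m (2 *m outer (ket z) (ket z) - mat 1))"

primrec circuit_op :: "complex ^ ('s \<times> 's) ^ ('s \<times> 's) \<Rightarrow> 's \<Rightarrow> gate list
    \<Rightarrow> complex ^ (bool \<times> 's \<times> 's) ^ (bool \<times> 's \<times> 's::finite)" where
  "circuit_op U z [] = mat 1"
| "circuit_op U z (g # gs) = circuit_op U z gs ** gate_op U z g"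

primrec gate_adj :: "gate \<Rightarrow> gate" where
  "gate_adj Query = QueryAdj"
| "gate_adj QueryAdj = Query"
| "gate_adj (SignalGate R) = SignalGate (dagger R)"
| "gate_adj CtrlSwap = CtrlSwap"
| "gate_adj CtrlReflect = CtrlReflect"

definition circuit_adj :: "gate list \<Rightarrow> gate list" where
  "circuit_adj gs = rev (map gate_adj gs)"

definition ctrl_walk_circuit :: "gate list" where
  "ctrl_walk_circuit = [CtrlSwap, QueryAdj, CtrlReflect, Query]"

primrec gqsp_circuit :: "(nat \<Rightarrow> complex ^ bool ^ bool) \<Rightarrow> nat \<Rightarrow> gate list" where
  "gqsp_circuit R 0 = [SignalGate (R 0)]"
| "gqsp_circuit R (Suc d) = gqsp_circuit R d @ ctrl_walk_circuit @ [SignalGate (R (Suc d))]"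

definition approx_rot_circuit ::
    "(nat \<Rightarrow> complex ^ bool ^ bool) \<Rightarrow> nat \<Rightarrow> real \<Rightarrow> gate list" where
  "approx_rot_circuit R d \<phi> =
     [Query] @ gqsp_circuit R d @ [SignalGate (signal_phase \<phi>)]
       @ circuit_adj (gqsp_circuit R d) @ [QueryAdj]"

definition query_count :: "gate list \<Rightarrow> nat" where
  "query_count gs = length (filter (\<lambda>g. g = Query \<or> g = QueryAdj) gs)"

text \<open>\<open>Signal\<close> is a single-qubit wire; \<open>RegA\<close> and \<open>RegB\<close> are the walk registers.\<close>

datatype wire = Signal | RegA | RegB

primrec gate_wires :: "gate \<Rightarrow> wire set" where
  "gate_wires Query = {RegA, RegB}"
| "gate_wires QueryAdj = {RegA, RegB}"
| "gate_wires (SignalGate R) = {Signal}"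
| "gate_wires CtrlSwap = {Signal, RegA, RegB}"
| "gate_wires CtrlReflect = {Signal, RegB}"

definition signal_qubits :: "gate list \<Rightarrow> nat" where
  "signal_qubits gs = card ((\<Union>g\<in>set gs. gate_wires g) - {RegA, RegB})"

end

theory Submission
  imports Defs "HOL-Computational_Algebra.Fundamental_Theorem_Algebra"
begin

text \<open>
  Let \<open>T\<close> be the step isometry and \<open>K\<close> the embedding \<open>w \<mapsto> |0\<rangle> \<otimes> w\<close>, so that
  \<open>(1 \<otimes> U) J = K T\<close>.  If \<open>W u = u\<close>, multiplying by the reflection \<open>2 T T\<^sup>\<dagger> - 1\<close> gives
  \<open>S u + u = 2 T a\<close> with \<open>a = T\<^sup>\<dagger> u\<close>; hence \<open>T a\<close> is swap-invariant, which by detailed balance says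
  that \<open>a(x) / sqrt (\<pi>(x))\<close> is constant along edges.  By irreducibility \<open>a\<close> is a multiple of
  \<open>|\<pi>\<rangle>\<close>, and therefore \<open>\<Pi>\<^sub>0 T = T |\<pi>\<rangle>\<langle>\<pi>|\<close>.

  The relation \<open>\<Upsilon>\<^sup>\<dagger>\<Upsilon> + \<Phi>\<^sup>\<dagger>\<Phi> = 1\<close> forces \<open>\<Phi>(W) \<Pi>\<^sub>0 = 0\<close>, so \<open>C\<close> fixes \<open>K \<Pi>\<^sub>0\<close> and the error equals
  \<open>(e\<^sup>i\<^sup>\<phi> - 1) (1 \<otimes> U\<^sup>\<dagger>) C\<^sup>\<dagger> K (\<Upsilon>(W) - \<Pi>\<^sub>0) T\<close>.  Its norm is at most \<open>2 \<epsilon>\<close> because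
  \<open>N = \<Upsilon>(W) - \<Pi>\<^sub>0\<close> attains its norm on an eigenvector of \<open>W\<close>: the top eigenspace of \<open>N\<^sup>\<dagger> N\<close> is
  \<open>W\<close>-invariant.
\<close>

section \<open>Complex matrices\<close>

lemma sum_prod_UNIV:
  fixes f :: "'a::finite \<times> 'b::finite \<Rightarrow> 'c::comm_monoid_add"
  shows "(\<Sum>p\<in>UNIV. f p) = (\<Sum>i\<in>UNIV. \<Sum>j\<in>UNIV. f (i, j))"
  by (simp add: sum.cartesian_product UNIV_Times_UNIV [symmetric] del: UNIV_Times_UNIV)

lemma dagger_nth: "dagger A $ i $ j = cnj (A $ j $ i)"
  by (simp add: dagger_def map_matrix_def transpose_def)

lemma cscale_nth: "(c *m A) $ i $ j = c * A $ i $ j"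
  by (simp add: cscale_def map_matrix_def)

lemma outer_nth: "outer u v $ i $ j = u $ i * cnj (v $ j)"
  by (simp add: outer_def)

lemma mtensor_nth: "(A \<otimes>m B) $ p $ q = A $ fst p $ fst q * B $ snd p $ snd q"
  by (simp add: mtensor_def)

lemma vtensor_nth: "(u \<otimes>v w) $ p = u $ fst p * w $ snd p"
  by (simp add: vtensor_def)

lemma mat_nth: "mat c $ i $ j = (if i = j then c else 0)"
  by (simp add: mat_def)

lemma matrix_mult_nth: "(A ** B) $ i $ j = (\<Sum>k\<in>UNIV. A $ i $ k * B $ k $ j)"
  by (simp add: matrix_matrix_mult_def)

lemma sum_mat_1_nth:
  fixes f :: "'n::finite \<Rightarrow> 'a::semiring_1"
  shows "(\<Sum>k\<in>UNIV. mat 1 $ i $ k * f k) = f i" "(\<Sum>k\<in>UNIV. mat 1 $ k $ i * f k) = f i"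
    "(\<Sum>k\<in>UNIV. f k * mat 1 $ i $ k) = f i" "(\<Sum>k\<in>UNIV. f k * mat 1 $ k $ i) = f i"
  by (simp_all add: mat_nth if_distrib [where f = "\<lambda>x. x * _"] if_distrib [where f = "\<lambda>x. _ * x"]
      cong: if_cong)

lemma cnj_mat_1_nth: "cnj (mat 1 $ i $ j) = mat 1 $ i $ j"
  by (simp add: mat_nth)

lemma dagger_dagger [simp]: "dagger (dagger A) = A"
  by (simp add: vec_eq_iff dagger_nth)

lemma dagger_mult: "dagger (A ** B) = dagger B ** dagger A"
  by (simp add: vec_eq_iff dagger_nth matrix_mult_nth mult.commute)

lemma dagger_diff: "dagger (A - B) = dagger A - dagger B"
  by (simp add: vec_eq_iff dagger_nth)

lemma dagger_mat [simp]: "dagger (mat 1) = mat 1"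
  by (simp add: vec_eq_iff dagger_nth mat_nth)

lemma dagger_cscale: "dagger (c *m A) = cnj c *m dagger A"
  by (simp add: vec_eq_iff dagger_nth cscale_nth)

lemma dagger_outer: "dagger (outer u v) = outer v u"
  by (simp add: vec_eq_iff dagger_nth outer_nth mult.commute)

lemma dagger_mtensor: "dagger (A \<otimes>m B) = dagger A \<otimes>m dagger B"
  by (simp add: vec_eq_iff dagger_nth mtensor_nth)

lemma cscale_mult_left: "(c *m A) ** B = c *m (A ** B)"
  by (simp add: vec_eq_iff cscale_nth matrix_mult_nth sum_distrib_left mult_ac)

lemma cscale_mult_right: "A ** (c *m B) = c *m (A ** B)"
  by (simp add: vec_eq_iff cscale_nth matrix_mult_nth sum_distrib_left mult_ac)

lemma cscale_diff: "c *m (A - B) = c *m A - c *m B"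
  by (simp add: vec_eq_iff cscale_nth algebra_simps)

lemma cscale_mult_vec: "(c *m A) *v v = c *s (A *v v)"
  by (simp add: vec_eq_iff cscale_nth matrix_vector_mult_def sum_distrib_left mult_ac)

lemma mult_vec_cmult: "A *v (c *s x) = c *s (A *v (x :: 'a::comm_semiring_1 ^ 'n))"
  by (simp add: vec_eq_iff matrix_vector_mult_def sum_distrib_left mult_ac)

lemma mult_vec_sum: "A *v (\<Sum>k\<in>S. f k) = (\<Sum>k\<in>S. A *v (f k :: 'a::semiring_1 ^ 'n))"
  by (induction S rule: infinite_finite_induct) (simp_all add: matrix_vector_right_distrib)

lemma matrix_diff_ldistrib:
  fixes A :: "'a::ring_1 ^ 'n ^ 'm"
  shows "A ** (B - C) = A ** B - A ** C"
  by (simp add: vec_eq_iff matrix_mult_nth algebra_simps sum_subtractf)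

lemma matrix_diff_rdistrib:
  fixes A :: "'a::ring_1 ^ 'n ^ 'm"
  shows "(A - B) ** C = A ** C - B ** C"
  by (simp add: vec_eq_iff matrix_mult_nth algebra_simps sum_subtractf)

lemma matrix_add_rdistrib:
  fixes A :: "'a::semiring_1 ^ 'n ^ 'm"
  shows "(A + B) ** C = A ** C + B ** C"
  by (simp add: vec_eq_iff matrix_mult_nth algebra_simps sum.distrib)

lemma matrix_mult_zero_right [simp]: "(A :: 'a::semiring_1 ^ 'n ^ 'm) ** 0 = 0"
  by (simp add: vec_eq_iff matrix_mult_nth)

lemma mtensor_mult: "(A \<otimes>m B) ** (C \<otimes>m D) = (A ** C) \<otimes>m (B ** D)"
  by (simp add: vec_eq_iff matrix_mult_nth mtensor_nth sum_prod_UNIV sum_product mult_ac)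

lemma mtensor_mat_1 [simp]: "mat 1 \<otimes>m mat 1 = mat 1"
  by (auto simp: vec_eq_iff mtensor_nth mat_nth prod_eq_iff)

lemma outer_mult_vec: "outer u v *v w = (\<Sum>j\<in>UNIV. cnj (v $ j) * w $ j) *s u"
  by (simp add: vec_eq_iff outer_nth matrix_vector_mult_def sum_distrib_left mult_ac)

lemma inner_dagger: "(A *v x) \<bullet> y = x \<bullet> (dagger A *v y)"
proof -
  have *: "a \<bullet> b = Re (cnj a * b)" for a b :: complex
    by (simp add: inner_complex_def)
  have "(A *v x) \<bullet> y = Re (\<Sum>i\<in>UNIV. \<Sum>j\<in>UNIV. cnj (A $ i $ j) * cnj (x $ j) * y $ i)"
    by (simp add: inner_vec_def * matrix_vector_mult_def sum_distrib_right)
  also have "\<dots> = Re (\<Sum>j\<in>UNIV. \<Sum>i\<in>UNIV. cnj (A $ i $ j) * cnj (x $ j) * y $ i)"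
    by (subst sum.swap) simp
  also have "\<dots> = x \<bullet> (dagger A *v y)"
    by (simp add: inner_vec_def * matrix_vector_mult_def dagger_nth sum_distrib_left mult_ac)
  finally show ?thesis .
qed

lemma norm_isometry:
  assumes "dagger A ** A = mat 1"
  shows "norm (A *v x) = norm x"
  using assms by (simp add: norm_eq_sqrt_inner inner_dagger matrix_vector_mul_assoc)

lemma norm_cmult_vec: "norm (c *s (x :: complex ^ 'n)) = cmod c * norm x"
proof -
  have "norm (c *s x) = L2_set (\<lambda>i. cmod c * cmod (x $ i)) UNIV"
    by (simp add: norm_vec_def norm_mult)
  thus ?thesis
    by (simp add: norm_vec_def L2_set_right_distrib)
qed

lemma dagger_mult_self_eq_0:
  assumes "dagger A ** A = 0"
  shows "A = 0"
proof -
  have "norm (A *v x) = 0" for x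
    using assms by (simp add: norm_eq_sqrt_inner inner_dagger matrix_vector_mul_assoc)
  thus ?thesis
    by (simp add: matrix_eq)
qed

lemma unitary_mult: "unitary A \<Longrightarrow> unitary B \<Longrightarrow> unitary (A ** B)"
  unfolding unitary_def dagger_mult
  by (metis matrix_mul_assoc matrix_mul_rid)

lemma unitary_mtensor: "unitary A \<Longrightarrow> unitary B \<Longrightarrow> unitary (A \<otimes>m B)"
  by (simp add: unitary_def dagger_mtensor mtensor_mult)

lemma unitary_mat_1: "unitary (mat 1)"
  by (simp add: unitary_def)

lemma bool_UNIV_sum: "(\<Sum>b\<in>UNIV. f b) = f False + f True"
  by (simp add: UNIV_bool add.commute)

lemma ctrl_nth:
  "ctrl U $ p $ q = (if fst p \<noteq> fst q then 0
     else if fst p then U $ snd p $ snd q else mat 1 $ snd p $ snd q)"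
  by (cases "fst p"; cases "fst q") (simp_all add: ctrl_def mtensor_nth outer_nth axis_def)

lemma dagger_ctrl: "dagger (ctrl U) = ctrl (dagger U)"
  by (auto simp: vec_eq_iff dagger_nth ctrl_nth mat_nth)

lemma ctrl_mult: "ctrl U ** ctrl V = ctrl (U ** V)"
  by (auto simp: vec_eq_iff matrix_mult_nth ctrl_nth sum_prod_UNIV bool_UNIV_sum sum_mat_1_nth)

lemma ctrl_conjugate:
  assumes "U ** V = mat 1"
  shows "(mat 1 \<otimes>m U) ** ctrl X ** (mat 1 \<otimes>m V) = ctrl (U ** X ** V)"
proof -
  have *: "mat 1 \<otimes>m A = outer (ket False) (ket False) \<otimes>m A + outer (ket True) (ket True) \<otimes>m A"
    for A :: "complex ^ 'n ^ 'n"
    by (auto simp: vec_eq_iff mtensor_nth outer_nth axis_def mat_nth)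
  show ?thesis
    using assms
    by (simp add: ctrl_def matrix_add_ldistrib matrix_add_rdistrib mtensor_mult)
qed

lemma ctrl_mat_1: "ctrl (mat 1) = (mat 1 :: complex ^ (bool \<times> 'n::finite) ^ (bool \<times> 'n))"
  by (auto simp: vec_eq_iff ctrl_nth mat_nth prod_eq_iff)

lemma unitary_ctrl: "unitary U \<Longrightarrow> unitary (ctrl U)"
  by (simp add: unitary_def dagger_ctrl ctrl_mult ctrl_mat_1)

lemma unitary_gqsp:
  assumes "unitary W" "\<And>i. i \<le> d \<Longrightarrow> unitary (R i)"
  shows "unitary (gqsp W R d)"
  using assms(2)
  by (induction d)
    (simp_all add: unitary_mult unitary_mtensor unitary_mat_1 unitary_ctrl assms(1))

lemma matrix_nth_eq: "matrix f $ i $ j = f (ket j) $ i"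
  by (simp add: matrix_def)

lemma mult_ket: "(A *v ket j) $ i = A $ i $ j"
  by (simp add: matrix_vector_mul_component axis_def matrix_vector_mult_def if_distrib cong: if_cong)

lemma ket_tensor_nth: "ket_tensor b A $ p $ j = (if fst p = b then A $ snd p $ j else 0)"
  by (simp add: ket_tensor_def matrix_nth_eq vtensor_nth mult_ket) (simp add: axis_def)

lemma ket_tensor_eq: "ket_tensor b A = ket_tensor b (mat 1) ** A"
  by (simp add: vec_eq_iff matrix_mult_nth ket_tensor_nth sum_mat_1_nth)

lemma dagger_ket_tensor_mult:
  "dagger (ket_tensor b (mat 1)) ** ket_tensor c (mat 1) = (if b = c then mat 1 else 0)"
  by (cases b; cases c)
    (simp_all add: vec_eq_iff matrix_mult_nth dagger_nth ket_tensor_nth sum_prod_UNIV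
      bool_UNIV_sum cnj_mat_1_nth sum_mat_1_nth)

lemma ket_tensor_mult_dagger:
  "ket_tensor b (mat 1) ** dagger (ket_tensor b (mat 1)) = outer (ket b) (ket b) \<otimes>m mat 1"
  by (auto simp: vec_eq_iff matrix_mult_nth dagger_nth ket_tensor_nth cnj_mat_1_nth
      sum_mat_1_nth mtensor_nth outer_nth axis_def) (simp_all add: mat_nth)

lemma mtensor_mult_ket_tensor:
  fixes A :: "complex ^ 'n::finite ^ 'n"
  shows "(mat 1 \<otimes>m A) ** ket_tensor b (mat 1) = ket_tensor b (mat 1) ** A"
proof -
  have "(mat 1 \<otimes>m A) ** ket_tensor b (mat 1) = ket_tensor b A"
    by (cases b) (simp_all add: vec_eq_iff matrix_mult_nth ket_tensor_nth mtensor_nth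
      sum_prod_UNIV bool_UNIV_sum sum_mat_1_nth, simp_all add: mat_nth)
  thus ?thesis
    by (simp add: ket_tensor_eq [of b A])
qed

section \<open>Polynomials of a matrix\<close>

lemma mat_pow_commute: "A ** mat_pow A k = mat_pow A k ** A"
  by (induction k) (simp, simp, metis matrix_mul_assoc)

lemma mat_poly_commute: "A ** mat_poly p A = mat_poly p A ** A"
proof -
  have l: "A ** sum f S = (\<Sum>k\<in>S. A ** f k)" if "finite S" for S :: "nat set" and f
    using that by induction (simp_all add: matrix_add_ldistrib)
  have r: "sum f S ** A = (\<Sum>k\<in>S. f k ** A)" if "finite S" for S :: "nat set" and f
    using that by induction (simp_all add: matrix_add_rdistrib)
  show ?thesis
    by (simp add: mat_poly_def l r cscale_mult_left cscale_mult_right mat_pow_commute)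
qed

lemma mat_pow_eigenvector:
  fixes A :: "complex ^ 'n ^ 'n"
  assumes "A *v v = l *s v"
  shows "mat_pow A k *v v = (l ^ k) *s v"
proof (induction k)
  case (Suc k)
  have "mat_pow A (Suc k) *v v = A *v (mat_pow A k *v v)"
    by (simp add: matrix_vector_mul_assoc)
  also have "\<dots> = l ^ k *s (A *v v)"
    by (simp only: Suc.IH mult_vec_cmult)
  finally show ?case
    by (simp add: assms mult.commute)
qed simp

lemma sum_mult_vec: "finite S \<Longrightarrow> (\<Sum>k\<in>S. f k) *v v = (\<Sum>k\<in>S. f k *v (v :: 'a::semiring_1 ^ 'n))"
  by (induction rule: finite_induct) (simp_all add: matrix_vector_mult_add_rdistrib)

lemma mat_poly_mult_vec: "mat_poly p A *v v = (\<Sum>k\<le>degree p. coeff p k *s (mat_pow A k *v v))"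
  by (simp add: mat_poly_def sum_mult_vec cscale_mult_vec)

lemma mat_poly_eigenvector:
  assumes "A *v v = l *s v"
  shows "mat_poly p A *v v = poly p l *s v"
  by (simp add: mat_poly_mult_vec mat_pow_eigenvector[OF assms] poly_altdef vec.scale_sum_left)

lemma mat_poly_mult_vec_le:
  assumes "degree p \<le> n"
  shows "mat_poly p A *v v = (\<Sum>k\<le>n. coeff p k *s (mat_pow A k *v v))"
  unfolding mat_poly_mult_vec
  by (rule sum.mono_neutral_left) (use assms in \<open>auto simp: coeff_eq_0\<close>)

lemma mat_poly_linear_factor:
  "mat_poly ([:- l, 1:] * q) A *v v = (A - l *m mat 1) *v (mat_poly q A *v v)"
proof -
  define n where "n = degree q"
  have "degree ([:- l, 1:] * q) \<le> Suc n"
    using degree_mult_le[of "[:- l, 1:]" q] by (simp add: n_def)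
  hence "mat_poly ([:- l, 1:] * q) A *v v
      = (\<Sum>k\<le>Suc n. (coeff (pCons 0 q) k - l * coeff q k) *s (mat_pow A k *v v))"
    by (subst mat_poly_mult_vec_le) (simp_all add: algebra_simps del: sum.atMost_Suc)
  also have "\<dots> = (\<Sum>k\<le>Suc n. coeff (pCons 0 q) k *s (mat_pow A k *v v))
      - l *s (\<Sum>k\<le>Suc n. coeff q k *s (mat_pow A k *v v))"
    by (simp add: sum_subtractf vec.scale_left_diff_distrib vec.scale_sum_right del: sum.atMost_Suc)
  also have "(\<Sum>k\<le>Suc n. coeff (pCons 0 q) k *s (mat_pow A k *v v))
      = (\<Sum>k\<le>n. coeff q k *s (A *v (mat_pow A k *v v)))"
    by (subst sum.atMost_Suc_shift) (simp add: matrix_vector_mul_assoc)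
  also have "\<dots> = A *v (mat_poly q A *v v)"
    by (simp add: mat_poly_mult_vec n_def mult_vec_sum mult_vec_cmult)
  also have "(\<Sum>k\<le>Suc n. coeff q k *s (mat_pow A k *v v)) = mat_poly q A *v v"
    by (rule mat_poly_mult_vec_le[symmetric]) (simp add: n_def)
  finally show ?thesis
    by (simp add: matrix_vector_mult_diff_rdistrib cscale_mult_vec)
qed

lemma exists_annihilating_poly:
  fixes A :: "complex ^ 'n ^ 'n"
  shows "\<exists>p. p \<noteq> 0 \<and> mat_poly p A *v v = 0"
proof -
  define f where "f k = mat_pow A k *v v" for k
  define N where "N = CARD('n)"
  have eval: "mat_poly p A *v v = (\<Sum>k\<le>N. c k *s f k)"
    if "p = (\<Sum>k\<le>N. monom (c k) k)" for p c
  proof -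
    have "degree p \<le> N"
      unfolding that by (rule degree_sum_le) (auto intro: order.trans[OF degree_monom_le])
    moreover have "coeff p k = c k" if "k \<le> N" for k
      using that by (simp add: \<open>p = _\<close> coeff_sum if_distrib cong: if_cong)
    ultimately show ?thesis
      by (simp add: mat_poly_mult_vec_le f_def)
  qed
  have "\<exists>c k. k \<le> N \<and> c k \<noteq> 0 \<and> (\<Sum>k\<le>N. c k *s f k) = 0"
  proof (cases "inj_on f {..N}")
    case True
    have "vec.dependent (f ` {..N})"
    proof (rule ccontr)
      assume "\<not> vec.dependent (f ` {..N})"
      hence "card (f ` {..N}) \<le> vec.dim (UNIV :: (complex ^ 'n) set)"
        by (intro vec.independent_card_le_dim) auto
      thus False
        using True by (simp add: card_image vec_dim_card card_cart_basis N_def)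
    qed
    then obtain u where u: "\<exists>w\<in>f ` {..N}. u w \<noteq> 0" "(\<Sum>w\<in>f ` {..N}. u w *s w) = 0"
      by (auto simp: vec.dependent_finite)
    from u(2) have "(\<Sum>k\<le>N. u (f k) *s f k) = 0"
      by (simp add: sum.reindex[OF True])
    with u(1) show ?thesis
      by (intro exI[of _ "\<lambda>k. u (f k)"]) auto
  next
    case False
    then obtain i j where ij: "i \<le> N" "j \<le> N" "i \<noteq> j" "f i = f j"
      by (auto simp: inj_on_def)
    define c :: "nat \<Rightarrow> complex" where "c k = (if k = i then 1 else 0) - (if k = j then 1 else 0)" for k
    have "(\<Sum>k\<le>N. c k *s f k)
        = (\<Sum>k\<le>N. (if k = i then f k else 0) - (if k = j then f k else 0))"
      by (intro sum.cong) (auto simp: c_def)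
    also have "\<dots> = 0"
      using ij by (simp add: sum_subtractf)
    finally show ?thesis
      using ij by (intro exI[of _ c] exI[of _ i]) (simp add: c_def)
  qed
  then obtain c k where ck: "k \<le> N" "c k \<noteq> 0" "(\<Sum>k\<le>N. c k *s f k) = 0"
    by blast
  define p where "p = (\<Sum>k\<le>N. monom (c k) k)"
  have "coeff p k = c k"
    using ck(1) by (simp add: p_def coeff_sum if_distrib cong: if_cong)
  with ck eval[OF p_def] show ?thesis
    by (metis coeff_0)
qed

lemma eigenvector_if_annihilated:
  fixes A :: "complex ^ 'n ^ 'n"
  assumes E: "vec.subspace E" "\<And>w. w \<in> E \<Longrightarrow> A *v w \<in> E"
    and "p \<noteq> 0" "mat_poly p A *v v = 0" "v \<in> E" "v \<noteq> 0"
  shows "\<exists>w\<in>E. w \<noteq> 0 \<and> (\<exists>l. A *v w = l *s w)"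
  using assms(3,4)
proof (induction "degree p" arbitrary: p rule: less_induct)
  case less
  have pow: "mat_pow A k *v v \<in> E" for k
    by (induction k) (simp_all add: assms(5) E(2) matrix_vector_mul_assoc[symmetric])
  have "\<not> constant (poly p)"
  proof
    assume "constant (poly p)"
    hence "degree p = 0"
      by (simp add: constant_degree)
    then obtain a where a: "p = [:a:]"
      by (rule degree_eq_zeroE)
    hence "mat_poly p A *v v = a *s v"
      by (simp add: mat_poly_mult_vec)
    with less.prems a \<open>v \<noteq> 0\<close> show False
      by simp
  qed
  then obtain l where "poly p l = 0"
    using fundamental_theorem_of_algebra by blast
  then obtain q where q: "p = [:- l, 1:] * q"
    by (auto simp: poly_eq_0_iff_dvd)
  define w where "w = mat_poly q A *v v"
  have "q \<noteq> 0"
    using less.prems(1) q by auto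
  show ?case
  proof (cases "w = 0")
    case True
    have "degree q < degree p"
      using \<open>q \<noteq> 0\<close> unfolding q by (subst degree_mult_eq) auto
    with less.hyps \<open>q \<noteq> 0\<close> True show ?thesis
      by (simp add: w_def)
  next
    case False
    have "w \<in> E"
      unfolding w_def mat_poly_mult_vec by (intro vec.subspace_sum vec.subspace_scale E(1) pow)
    moreover have "A *v w = l *s w"
      using less.prems(2) unfolding q mat_poly_linear_factor w_def[symmetric]
      by (simp add: matrix_vector_mult_diff_rdistrib cscale_mult_vec)
    ultimately show ?thesis
      using False by blast
  qed
qed

lemma eigenvector_in_invariant_subspace:
  fixes A :: "complex ^ 'n ^ 'n"
  assumes "vec.subspace E" "\<And>w. w \<in> E \<Longrightarrow> A *v w \<in> E" "v \<in> E" "v \<noteq> 0"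
  obtains w l where "w \<in> E" "w \<noteq> 0" "A *v w = l *s w"
  using eigenvector_if_annihilated[OF assms(1,2)] exists_annihilating_poly[of A v] assms(3,4)
  by metis

section \<open>Operator norms of matrices commuting with a unitary\<close>

lemma unitary_commute_dagger:
  assumes "unitary W" "W ** N = N ** W"
  shows "W ** dagger N = dagger N ** W"
proof -
  have u: "dagger W ** W = mat 1" "W ** dagger W = mat 1"
    using assms(1) by (auto simp: unitary_def)
  have "N ** dagger W = dagger W ** (W ** N) ** dagger W"
    by (simp add: matrix_mul_assoc u)
  also have "\<dots> = dagger W ** N"
    by (simp add: assms(2) matrix_mul_assoc [symmetric] u)
  finally have "dagger (N ** dagger W) = dagger (dagger W ** N)"
    by simp
  thus ?thesis
    by (simp add: dagger_mult)
qed

lemma attains_max_norm: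
  fixes N :: "complex ^ 'n ^ 'm"
  obtains v where "norm v = 1" "\<And>x. norm (N *v x) \<le> norm (N *v v) * norm x"
proof -
  have "continuous_on (sphere 0 1) (\<lambda>x. norm (N *v x))"
    by (intro continuous_on_norm matrix_vector_mult_linear_continuous_on)
  moreover have "sphere (0 :: complex ^ 'n) 1 \<noteq> {}"
    by simp
  ultimately obtain v where v: "v \<in> sphere 0 1"
    "\<And>y. y \<in> sphere 0 1 \<Longrightarrow> norm (N *v y) \<le> norm (N *v v)"
    using continuous_attains_sup[of "sphere 0 1"] compact_sphere by metis
  have "norm (N *v x) \<le> norm (N *v v) * norm x" for x
  proof (cases "x = 0")
    case False
    have "norm (N *v ((1 / norm x) *\<^sub>R x)) \<le> norm (N *v v)"
      using False by (intro v(2)) simp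
    thus ?thesis
      using False
      by (simp add: linear_cmul [OF matrix_vector_mul_linear] pos_divide_le_eq)
  qed simp
  with v(1) show ?thesis
    by (intro that) simp_all
qed

lemma norm_le_if_eigenvectors:
  fixes W N :: "complex ^ 'n ^ 'n"
  assumes "unitary W" "W ** N = N ** W"
    and eig: "\<And>v l. v \<noteq> 0 \<Longrightarrow> W *v v = l *s v \<Longrightarrow> norm (N *v v) \<le> e * norm v"
  shows "norm (N *v x) \<le> e * norm x"
proof -
  obtain v where v: "norm v = 1" "\<And>x. norm (N *v x) \<le> norm (N *v v) * norm x"
    using attains_max_norm[of N] by blast
  define s where "s = norm (N *v v)"
  define M where "M = dagger N ** N"
  have s: "norm (N *v x) \<le> s * norm x" "0 \<le> s" for x
    using v(2) by (simp_all add: s_def)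
  have M_inner: "(M *v x) \<bullet> y = (N *v x) \<bullet> (N *v y)" for x y
    by (simp add: M_def matrix_vector_mul_assoc [symmetric] inner_dagger)
  have M_norm: "norm (M *v v) \<le> s\<^sup>2"
  proof -
    have "(norm (M *v v))\<^sup>2 = (N *v v) \<bullet> (N *v (M *v v))"
      by (simp add: power2_norm_eq_inner M_inner)
    also have "\<dots> \<le> s * (s * norm (M *v v))"
      using norm_cauchy_schwarz[of "N *v v" "N *v (M *v v)"] mult_left_mono[OF s(1)[of "M *v v"] s(2)]
      by (simp flip: s_def)
    finally have "norm (M *v v) * norm (M *v v) \<le> s\<^sup>2 * norm (M *v v)"
      by (simp add: power2_eq_square mult_ac)
    thus ?thesis
      by (cases "norm (M *v v) = 0") auto
  qed
  have v_eig: "M *v v = of_real (s\<^sup>2) *s v"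
  proof -
    have "(norm (M *v v - s\<^sup>2 *\<^sub>R v))\<^sup>2
        = (norm (M *v v))\<^sup>2 - 2 * s\<^sup>2 * ((M *v v) \<bullet> v) + (s\<^sup>2)\<^sup>2 * (norm v)\<^sup>2"
      unfolding power2_norm_eq_inner
      by (simp add: inner_diff_left inner_diff_right inner_commute[of v "M *v v"] power2_eq_square
          algebra_simps)
    also have "(M *v v) \<bullet> v = s\<^sup>2"
      by (simp add: M_inner s_def power2_norm_eq_inner)
    also have "(norm (M *v v))\<^sup>2 \<le> (s\<^sup>2)\<^sup>2"
      using M_norm by (intro power_mono) auto
    finally have "(norm (M *v v - s\<^sup>2 *\<^sub>R v))\<^sup>2 \<le> 0"
      using v(1) by (simp add: power2_eq_square)
    hence "M *v v - s\<^sup>2 *\<^sub>R v = 0"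
      by simp
    moreover have "s\<^sup>2 *\<^sub>R v = of_real (s\<^sup>2) *s v"
      by (simp add: vec_eq_iff scaleR_conv_of_real [where 'a = complex])
    ultimately show ?thesis
      by simp
  qed
  define E where "E = {w. M *v w = of_real (s\<^sup>2) *s w}"
  have "W ** M = M ** W"
    unfolding M_def
    by (metis matrix_mul_assoc assms(2) unitary_commute_dagger[OF assms(1,2)])
  hence inv: "W *v w \<in> E" if "w \<in> E" for w
    using that unfolding E_def
    by (metis (mono_tags) mem_Collect_eq matrix_vector_mul_assoc mult_vec_cmult)
  have "vec.subspace E"
    by (rule vec.subspaceI)
      (auto simp: E_def matrix_vector_right_distrib mult_vec_cmult vec.scale_right_distrib
        vec.scale_left_commute mult.commute)
  moreover have "v \<in> E" "v \<noteq> 0"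
    using v_eig v(1) by (auto simp: E_def)
  ultimately obtain w l where w: "w \<in> E" "w \<noteq> 0" "W *v w = l *s w"
    using eigenvector_in_invariant_subspace inv by metis
  have "(norm (N *v w))\<^sup>2 = (s * norm w)\<^sup>2"
  proof -
    have "M *v w = s\<^sup>2 *\<^sub>R w"
      using w(1) by (simp add: E_def vec_eq_iff scaleR_conv_of_real [where 'a = complex])
    hence "(M *v w) \<bullet> w = s\<^sup>2 * (norm w)\<^sup>2"
      by (simp add: power2_norm_eq_inner)
    thus ?thesis
      by (simp add: M_inner power2_norm_eq_inner power_mult_distrib)
  qed
  hence "norm (N *v w) = s * norm w"
    using s(2) by simp
  with eig[OF w(2,3)] w(2) have "s \<le> e"
    by simp
  thus ?thesis
    using s(1)[of x] by (meson mult_right_mono norm_ge_zero order.trans)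
qed

lemma unitary_eigenvalue_norm:
  assumes "unitary W" "W *v v = l *s v" "v \<noteq> 0"
  shows "cmod l = 1"
proof -
  have "norm v = norm (W *v v)"
    using assms(1) by (simp add: unitary_def norm_isometry)
  thus ?thesis
    using assms(2,3) by (simp add: norm_cmult_vec)
qed

lemma orth_proj_onto_kernel:
  assumes "unitary W" and Q: "is_orth_proj_onto Q {v. (W - mat 1) *v v = 0}"
  shows "Q ** Q = Q" "dagger Q = Q" "W *v v = v \<Longrightarrow> Q *v v = v" "W ** Q = Q" "Q ** W = Q"
proof -
  show QQ: "Q ** Q = Q" and dQ: "dagger Q = Q"
    using Q by (auto simp: is_orth_proj_onto_def)
  have r: "range ((*v) Q) = {v. W *v v = v}"
    using Q by (simp add: is_orth_proj_onto_def matrix_vector_mult_diff_rdistrib)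
  show "Q *v v = v" if "W *v v = v" for v
  proof -
    have "v \<in> range ((*v) Q)"
      using r that by simp
    then obtain u where "v = Q *v u"
      by blast
    thus ?thesis
      by (simp add: matrix_vector_mul_assoc QQ)
  qed
  have "W *v (Q *v x) = Q *v x" for x
    using r by blast
  thus WQ: "W ** Q = Q"
    by (simp add: matrix_eq matrix_vector_mul_assoc)
  have "Q ** dagger W = Q"
    using arg_cong[OF WQ, of dagger] by (simp add: dagger_mult dQ)
  hence "Q ** W = Q ** (dagger W ** W)"
    by (simp add: matrix_mul_assoc)
  thus "Q ** W = Q"
    using assms(1) by (simp add: unitary_def)
qed

lemma mat_poly_mult_fixed:
  assumes "W ** Q = Q" "poly p 1 = 1"
  shows "mat_poly p W ** Q = Q"
proof -
  have "mat_poly p W *v (Q *v x) = Q *v x" for x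
    using mat_poly_eigenvector[of W "Q *v x" 1 p] assms by (simp add: matrix_vector_mul_assoc)
  thus ?thesis
    by (simp add: matrix_eq matrix_vector_mul_assoc)
qed

lemma mat_poly_minus_projector_norm:
  fixes W :: "complex ^ 'n ^ 'n"
  assumes W: "unitary W" and Q: "is_orth_proj_onto Q {v. (W - mat 1) *v v = 0}"
    and "poly p 1 = 1" "0 \<le> e"
    and p: "\<And>t. cis t \<in> spec W \<Longrightarrow> cis t \<noteq> 1 \<Longrightarrow> cmod (poly p (cis t)) \<le> e"
  shows "norm ((mat_poly p W - Q) *v x) \<le> e * norm x"
proof (rule norm_le_if_eigenvectors[OF W])
  note Q' = orth_proj_onto_kernel[OF W Q]
  show "W ** (mat_poly p W - Q) = (mat_poly p W - Q) ** W"
    by (simp add: matrix_diff_ldistrib matrix_diff_rdistrib mat_poly_commute Q')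
  fix v l
  assume v: "v \<noteq> 0" "W *v v = l *s v"
  show "norm ((mat_poly p W - Q) *v v) \<le> e * norm v"
  proof (cases "l = 1")
    case True
    hence "(mat_poly p W - Q) *v v = 0"
      using v mat_poly_eigenvector[OF v(2), of p] Q'(3)[of v] assms(3)
      by (simp add: matrix_vector_mult_diff_rdistrib)
    thus ?thesis
      using assms(4) by simp
  next
    case False
    have "Q *v v = Q *v (W *v v)"
      by (simp add: matrix_vector_mul_assoc Q')
    hence "Q *v v = l *s (Q *v v)"
      by (simp only: v(2) mult_vec_cmult)
    hence "1 *s (Q *v v) = l *s (Q *v v)"
      by simp
    hence "Q *v v = 0"
      using False by (simp only: vec.scale_cancel_right) simp
    hence "(mat_poly p W - Q) *v v = poly p l *s v"
      using False by (simp add: matrix_vector_mult_diff_rdistrib mat_poly_eigenvector[OF v(2)])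
    moreover obtain t where "l = cis t"
      using unitary_eigenvalue_norm[OF W v(2,1)] by (metis complex_norm_eq_1_exp_eq cis_conv_exp)
    moreover have "l \<in> spec W"
      using v by (auto simp: spec_def)
    ultimately show ?thesis
      using p[of t] False by (simp add: norm_cmult_vec mult_right_mono)
  qed
qed

section \<open>The Szegedy walk of a reversible chain\<close>

lemma reachable_closed:
  assumes "x \<in> X" "\<And>x y. x \<in> X \<Longrightarrow> 0 < P $ x $ y \<Longrightarrow> y \<in> X"
    and "\<And>x y. 0 \<le> P $ x $ y" "(mat_pow P t $ x $ y :: real) > 0"
  shows "y \<in> X"
  using assms(1,4)
proof (induction t arbitrary: x)
  case 0
  thus ?case
    by (simp add: mat_nth split: if_splits)
next
  case (Suc t)
  have "\<exists>k. P $ x $ k * mat_pow P t $ k $ y > 0"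
  proof (rule ccontr)
    assume "\<nexists>k. P $ x $ k * mat_pow P t $ k $ y > 0"
    hence "mat_pow P (Suc t) $ x $ y \<le> 0"
      by (auto simp: matrix_mult_nth not_less intro!: sum_nonpos)
    thus False
      using Suc.prems by simp
  qed
  then obtain k where "P $ x $ k * mat_pow P t $ k $ y > 0"
    by blast
  hence "P $ x $ k > 0" "mat_pow P t $ k $ y > 0"
    using assms(3)[of x k] by (auto simp: zero_less_mult_iff)
  thus ?case
    using Suc.IH Suc.prems(1) assms(2) by blast
qed

lemma stationary_pos:
  assumes "stochastic P" "ergodic P" "stationary P p" "reversible P p"
  shows "0 < p $ x"
proof -
  have nn: "0 \<le> p $ x" "0 \<le> P $ x $ y" for x y
    using assms by (auto simp: stationary_def stochastic_def)
  have "(\<Sum>x\<in>UNIV. p $ x) \<noteq> 0"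
    using assms by (simp add: stationary_def)
  then obtain x0 where "p $ x0 \<noteq> 0"
    by (meson sum.neutral)
  moreover obtain t where "0 < mat_pow P t $ x0 $ x"
    using assms(2) unfolding ergodic_def by blast
  moreover have "b \<in> {y. 0 < p $ y}" if a: "a \<in> {y. 0 < p $ y}" "0 < P $ a $ b" for a b
  proof -
    have "p $ a * P $ a $ b = p $ b * P $ b $ a"
      using assms(4) unfolding reversible_def by blast
    with a have "0 < p $ b * P $ b $ a"
      by (metis mem_Collect_eq mult_pos_pos)
    thus "b \<in> {y. 0 < p $ y}"
      using nn(1)[of b] by (auto simp: zero_less_mult_iff order.strict_iff_order)
  qed
  ultimately have "x \<in> {y. 0 < p $ y}"
    using nn by (intro reachable_closed[of x0 "{y. 0 < p $ y}" P t x]) (auto simp: order.strict_iff_order)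
  thus ?thesis
    by simp
qed

lemma proportional_stat_ket:
  fixes P :: "real ^ 's ^ 's"
  assumes chain: "stochastic P" "ergodic P" "stationary P p" "reversible P p"
    and a: "\<And>x y. a $ x * of_real (sqrt (P $ x $ y)) = a $ y * of_real (sqrt (P $ y $ x))"
  obtains c where "a = c *s stat_ket p"
proof -
  note pos = stationary_pos[OF chain]
  fix x0 :: 's
  define c where "c = a $ x0 / of_real (sqrt (p $ x0))"
  define X where "X = {y. a $ y = c * of_real (sqrt (p $ y))}"
  have x0: "x0 \<in> X"
    using pos[of x0] by (simp add: c_def X_def)
  have closed: "y \<in> X" if x: "x \<in> X" and Pxy: "0 < P $ x $ y" for x y
  proof -
    have rev: "p $ x * P $ x $ y = p $ y * P $ y $ x"
      using chain(4) unfolding reversible_def by blast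
    have db: "sqrt (p $ x) * sqrt (P $ x $ y) = sqrt (p $ y) * sqrt (P $ y $ x)"
      by (simp only: rev flip: real_sqrt_mult)
    have Pyx: "0 < P $ y $ x"
      using pos Pxy rev by (metis mult_pos_pos zero_less_mult_pos)
    have "a $ y * of_real (sqrt (P $ y $ x)) = a $ x * of_real (sqrt (P $ x $ y))"
      by (rule a [symmetric])
    also have "\<dots> = c * of_real (sqrt (p $ x) * sqrt (P $ x $ y))"
      using x by (simp add: X_def)
    also have "\<dots> = c * of_real (sqrt (p $ y)) * of_real (sqrt (P $ y $ x))"
      by (simp add: db)
    finally show ?thesis
      using Pyx by (simp add: X_def)
  qed
  have nn: "0 \<le> P $ x $ y" for x y
    using chain(1) by (simp add: stochastic_def)
  have "y \<in> X" for y
  proof -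
    obtain t where "0 < mat_pow P t $ x0 $ y"
      using chain(2) unfolding ergodic_def by blast
    thus ?thesis
      using reachable_closed[of x0 X P t y] x0 closed nn by blast
  qed
  thus ?thesis
    by (intro that[of c]) (simp add: vec_eq_iff stat_ket_def X_def)
qed

lemma step_iso_nth:
  "step_iso P $ p $ x = mat 1 $ fst p $ x * of_real (sqrt (P $ fst p $ snd p))"
  by (simp add: step_iso_def vtensor_nth row_ket_def axis_def mat_nth)

lemma swap_op_nth: "swap_op $ p $ q = mat 1 $ prod.swap p $ q"
  by (auto simp: swap_op_def vtensor_nth axis_def mat_nth prod_eq_iff)

lemma dagger_swap_op: "dagger swap_op = swap_op"
  by (auto simp: vec_eq_iff dagger_nth swap_op_nth mat_nth prod_eq_iff)

lemma swap_op_mult_vec: "(swap_op *v u) $ (x, y) = u $ (y, x)"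
  by (simp add: matrix_vector_mult_def swap_op_nth sum_mat_1_nth)

lemma swap_op_square: "swap_op ** swap_op = mat 1"
  by (auto simp: matrix_eq vec_eq_iff swap_op_mult_vec simp flip: matrix_vector_mul_assoc)

lemma unitary_swap_op: "unitary swap_op"
  by (simp add: unitary_def dagger_swap_op swap_op_square)

lemma step_iso_mult_vec: "(step_iso P *v a) $ (x, y) = a $ x * of_real (sqrt (P $ x $ y))"
  by (simp add: matrix_vector_mult_def step_iso_nth mult.assoc sum_mat_1_nth mult.commute [of "of_real _"])

lemma dagger_step_iso_mult:
  assumes "stochastic P"
  shows "dagger (step_iso P) ** step_iso P = mat 1"
proof -
  have "dagger (step_iso P) *v (step_iso P *v a) = a" for a
  proof -
    have sq: "complex_of_real (sqrt (P $ x $ y)) * (c * of_real (sqrt (P $ x $ y)))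
        = c * of_real (P $ x $ y)" for x y c
      using assms
      by (simp add: stochastic_def mult.left_commute [of _ c] flip: of_real_mult)
    have "(dagger (step_iso P) *v (step_iso P *v a)) $ x
        = (\<Sum>i\<in>UNIV. mat 1 $ i $ x * (a $ i * (\<Sum>y\<in>UNIV. of_real (P $ i $ y))))" for x
      by (simp add: matrix_vector_mult_def [of "dagger _"] dagger_nth step_iso_nth step_iso_mult_vec
          sum_prod_UNIV cnj_mat_1_nth mult.assoc sum_distrib_left sq)
    moreover have "(\<Sum>y\<in>UNIV. complex_of_real (P $ x $ y)) = 1" for x
      using assms by (simp add: stochastic_def flip: of_real_sum)
    ultimately show ?thesis
      by (simp add: vec_eq_iff sum_mat_1_nth)
  qed
  thus ?thesis
    by (simp add: matrix_eq matrix_vector_mul_assoc)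
qed

lemma projector_reflection_square:
  assumes "dagger T ** T = mat 1"
  shows "(2 *m (T ** dagger T) - mat 1) ** (2 *m (T ** dagger T) - mat 1) = mat 1"
proof -
  have "T ** dagger T ** (T ** dagger T) = T ** (dagger T ** T) ** dagger T"
    by (simp add: matrix_mul_assoc)
  hence "T ** dagger T ** (T ** dagger T) = T ** dagger T"
    by (simp add: assms)
  thus ?thesis
    by (simp add: matrix_diff_ldistrib matrix_diff_rdistrib cscale_mult_left cscale_mult_right)
      (simp add: vec_eq_iff cscale_nth)
qed

lemma unitary_walk:
  assumes "stochastic P"
  shows "unitary (walk P)"
  unfolding walk_def
  by (intro unitary_mult unitary_swap_op)
    (simp add: unitary_def dagger_diff dagger_cscale dagger_mult
      projector_reflection_square dagger_step_iso_mult assms)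

lemma step_iso_stat_ket:
  assumes "reversible P p"
  shows "swap_op *v (step_iso P *v stat_ket p) = step_iso P *v stat_ket p"
proof -
  have rev: "p $ x * P $ x $ y = p $ y * P $ y $ x" for x y
    using assms unfolding reversible_def by blast
  have "sqrt (p $ x) * sqrt (P $ x $ y) = sqrt (p $ y) * sqrt (P $ y $ x)" for x y
    by (simp only: rev [of x y] flip: real_sqrt_mult)
  thus ?thesis
    by (auto simp: vec_eq_iff swap_op_mult_vec step_iso_mult_vec stat_ket_def simp flip: of_real_mult)
qed

lemma walk_step_iso_stat_ket:
  assumes "stochastic P" "reversible P p"
  shows "walk P *v (step_iso P *v stat_ket p) = step_iso P *v stat_ket p"
proof -
  have "dagger (step_iso P) *v (step_iso P *v v) = v" for v
    by (simp add: matrix_vector_mul_assoc dagger_step_iso_mult assms(1))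
  thus ?thesis
    by (simp add: walk_def step_iso_stat_ket[OF assms(2)] matrix_vector_mult_diff_rdistrib
        cscale_mult_vec flip: matrix_vector_mul_assoc) (simp add: vec_eq_iff)
qed

lemma dagger_step_iso_walk_fixed:
  assumes chain: "stochastic P" "ergodic P" "stationary P p" "reversible P p"
    and u: "walk P *v u = u"
  obtains c where "dagger (step_iso P) *v u = c *s stat_ket p"
proof -
  define a where "a = dagger (step_iso P) *v u"
  define Rf where "Rf = 2 *m (step_iso P ** dagger (step_iso P)) - mat 1"
  have Rf: "Rf ** Rf = mat 1"
    unfolding Rf_def by (rule projector_reflection_square[OF dagger_step_iso_mult[OF chain(1)]])
  have "swap_op *v u = Rf *v (walk P *v u)"
    by (simp add: walk_def matrix_vector_mul_assoc matrix_mul_assoc Rf flip: Rf_def)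
  also have "\<dots> = 2 *s (step_iso P *v a) - u"
    by (simp add: u Rf_def a_def matrix_vector_mult_diff_rdistrib cscale_mult_vec
        flip: matrix_vector_mul_assoc)
  finally have Su: "step_iso P *v a = (1 / 2) *s (swap_op *v u + u)"
    by (simp add: vec_eq_iff field_simps)
  have "swap_op *v (step_iso P *v a) = step_iso P *v a"
    unfolding Su by (auto simp: vec_eq_iff swap_op_mult_vec add.commute mult_vec_cmult
        matrix_vector_right_distrib)
  hence "(step_iso P *v a) $ (x, y) = (step_iso P *v a) $ (y, x)" for x y
    by (metis swap_op_mult_vec)
  hence "a $ x * of_real (sqrt (P $ x $ y)) = a $ y * of_real (sqrt (P $ y $ x))" for x y
    by (simp add: step_iso_mult_vec)
  thus ?thesis
    using proportional_stat_ket[OF chain, of a] that unfolding a_def by metis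
qed

lemma mult_outer: "A ** outer u v = outer (A *v u) v"
  by (simp add: vec_eq_iff outer_nth matrix_mult_nth matrix_vector_mult_def
      sum_distrib_left sum_distrib_right mult_ac)

lemma kernel_projector_step_iso:
  fixes P :: "real ^ 's ^ 's"
  assumes chain: "stochastic P" "ergodic P" "stationary P p" "reversible P p"
    and Q: "is_orth_proj_onto Q {v. (walk P - mat 1) *v v = 0}"
  shows "Q ** step_iso P = step_iso P ** outer (stat_ket p) (stat_ket p)"
proof -
  let ?T = "step_iso P" and ?p = "stat_ket p"
  let ?G = "outer ?p ?p"
  note Q' = orth_proj_onto_kernel[OF unitary_walk[OF chain(1)] Q]
  have "(\<Sum>j\<in>UNIV. cnj (?p $ j) * ?p $ j) = (\<Sum>j\<in>UNIV. of_real (p $ j))"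
    using stationary_pos[OF chain] by (simp add: stat_ket_def less_imp_le flip: of_real_mult)
  also have "\<dots> = 1"
    using chain(3) by (simp add: stationary_def flip: of_real_sum)
  finally have "?G *v ?p = ?p"
    by (simp add: outer_mult_vec)
  hence "dagger ?T *v (Q *v w) = ?G *v (dagger ?T *v (Q *v w))" for w
    using dagger_step_iso_walk_fixed[OF chain, of "Q *v w"] Q'(4)
    by (metis matrix_vector_mul_assoc mult_vec_cmult)
  hence "dagger ?T ** Q = ?G ** dagger ?T ** Q"
    by (simp add: matrix_eq matrix_vector_mul_assoc matrix_mul_assoc)
  hence "dagger (dagger ?T ** Q) = dagger (?G ** dagger ?T ** Q)"
    by simp
  hence "Q ** ?T = Q ** (?T ** ?G)"
    by (simp add: dagger_mult Q'(2) dagger_outer)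
  also have "\<dots> = ?T ** ?G"
    using Q'(3)[OF walk_step_iso_stat_ket[OF chain(1,4)]] by (simp add: mult_outer)
  finally show ?thesis .
qed

section \<open>Oracle circuits\<close>

definition append_ket :: "'s::finite \<Rightarrow> complex ^ 's ^ ('s \<times> 's)" where
  "append_ket z = (\<chi> p x. (ket x \<otimes>v ket z) $ p)"

lemma append_ket_nth: "append_ket z $ p $ x = mat 1 $ fst p $ x * ket z $ snd p"
  by (simp add: append_ket_def vtensor_nth axis_def mat_nth)

lemma append_ket_mult_dagger:
  "append_ket z ** dagger (append_ket z) = mat 1 \<otimes>m outer (ket z) (ket z)"
  by (simp add: vec_eq_iff matrix_mult_nth dagger_nth append_ket_nth mtensor_nth outer_nth
      cnj_mat_1_nth sum_mat_1_nth mult.assoc) (simp add: axis_def mat_nth)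

lemma signal_embed_eq: "signal_embed z = ket_tensor False (mat 1) ** append_ket z"
proof -
  have "signal_embed z $ (b, q) $ x = (ket_tensor False (mat 1) ** append_ket z) $ (b, q) $ x" for b q x
    by (cases b) (simp_all add: signal_embed_def matrix_nth_eq vtensor_nth matrix_mult_nth
      ket_tensor_nth sum_mat_1_nth append_ket_nth, simp_all add: axis_def mat_nth)
  thus ?thesis
    by (simp add: vec_eq_iff)
qed

lemma oracle_append_ket:
  assumes "is_oracle P z U"
  shows "U ** append_ket z = step_iso P"
proof -
  have "(U ** append_ket z) $ p $ x = (U *v (ket x \<otimes>v ket z)) $ p" for p x
    by (simp add: matrix_mult_nth append_ket_def matrix_vector_mult_def)
  thus ?thesis
    using assms by (simp add: is_oracle_def vec_eq_iff step_iso_def)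
qed

lemma walk_eq_oracle:
  assumes "is_oracle P z U"
  shows "walk P = U ** (mat 1 \<otimes>m (2 *m outer (ket z) (ket z) - mat 1)) ** dagger U ** swap_op"
proof -
  have U: "U ** dagger U = mat 1"
    using assms by (simp add: is_oracle_def unitary_def)
  have "mat 1 \<otimes>m (2 *m outer (ket z) (ket z) - mat 1)
      = 2 *m (mat 1 \<otimes>m outer (ket z) (ket z)) - mat 1 \<otimes>m mat 1"
    by (simp only: vec_eq_iff mtensor_nth cscale_nth vector_minus_component) (simp add: algebra_simps)
  also have "\<dots> = 2 *m (append_ket z ** dagger (append_ket z)) - mat 1"
    by (simp add: append_ket_mult_dagger)
  finally have "U ** (mat 1 \<otimes>m (2 *m outer (ket z) (ket z) - mat 1)) ** dagger U
      = 2 *m (U ** append_ket z ** dagger (U ** append_ket z)) - mat 1"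
    by (simp add: matrix_diff_ldistrib matrix_diff_rdistrib cscale_mult_left cscale_mult_right
        dagger_mult matrix_mul_assoc U)
  thus ?thesis
    by (simp add: walk_def oracle_append_ket[OF assms])
qed

lemma circuit_op_append: "circuit_op U z (gs @ hs) = circuit_op U z hs ** circuit_op U z gs"
  by (induction gs) (simp_all add: matrix_mul_assoc)

lemma gate_op_adj: "gate_op U z (gate_adj g) = dagger (gate_op U z g)"
  by (cases g) (simp_all add: dagger_mtensor dagger_ctrl dagger_swap_op dagger_diff dagger_cscale
      dagger_outer)

lemma circuit_op_adj: "circuit_op U z (circuit_adj gs) = dagger (circuit_op U z gs)"
  by (induction gs) (simp_all add: circuit_adj_def circuit_op_append gate_op_adj dagger_mult)

lemma circuit_op_ctrl_walk:
  assumes "is_oracle P z U"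
  shows "circuit_op U z ctrl_walk_circuit = ctrl (walk P)"
proof -
  have "U ** dagger U = mat 1"
    using assms by (simp add: is_oracle_def unitary_def)
  thus ?thesis
    by (simp add: ctrl_walk_circuit_def ctrl_conjugate ctrl_mult walk_eq_oracle[OF assms])
qed

lemma circuit_op_gqsp:
  assumes "is_oracle P z U"
  shows "circuit_op U z (gqsp_circuit R d) = gqsp (walk P) R d"
  by (induction d) (simp_all add: circuit_op_append circuit_op_ctrl_walk[OF assms])

lemma circuit_op_approx_rot:
  assumes "is_oracle P z U"
  shows "circuit_op U z (approx_rot_circuit R d \<phi>) = approx_rot U (gqsp (walk P) R d) \<phi>"
  by (simp add: approx_rot_circuit_def approx_rot_def circuit_op_append circuit_op_adj
      circuit_op_gqsp[OF assms] matrix_mul_assoc)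

lemma query_count_append: "query_count (gs @ hs) = query_count gs + query_count hs"
  by (simp add: query_count_def)

lemma query_count_adj: "query_count (circuit_adj gs) = query_count gs"
proof (induction gs)
  case (Cons g gs)
  thus ?case
    by (cases g) (simp_all add: query_count_def circuit_adj_def)
qed (simp add: query_count_def circuit_adj_def)

lemma query_count_gqsp: "query_count (gqsp_circuit R d) = 2 * d"
  by (induction d) (simp_all add: query_count_append, simp_all add: query_count_def ctrl_walk_circuit_def)

lemma query_count_approx_rot: "query_count (approx_rot_circuit R d \<phi>) = 4 * d + 2"
  unfolding approx_rot_circuit_def query_count_append query_count_adj query_count_gqsp
  by (simp add: query_count_def)

lemma signal_qubits_approx_rot: "signal_qubits (approx_rot_circuit R d \<phi>) = 1"
proof -
  have "(\<Union>g\<in>set (approx_rot_circuit R d \<phi>). gate_wires g) - {RegA, RegB} = {Signal}"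
  proof
    show "(\<Union>g\<in>set (approx_rot_circuit R d \<phi>). gate_wires g) - {RegA, RegB} \<subseteq> {Signal}"
      using wire.exhaust by blast
  next
    have "SignalGate (signal_phase \<phi>) \<in> set (approx_rot_circuit R d \<phi>)"
      by (simp add: approx_rot_circuit_def)
    thus "{Signal} \<subseteq> (\<Union>g\<in>set (approx_rot_circuit R d \<phi>). gate_wires g) - {RegA, RegB}"
      by force
  qed
  thus ?thesis
    by (simp add: signal_qubits_def)
qed

section \<open>Error of the approximate rotation\<close>

lemma signal_phase_mtensor:
  "signal_phase \<phi> \<otimes>m mat 1
     = mat 1 + (cis \<phi> - 1) *m (ket_tensor False (mat 1) ** dagger (ket_tensor False (mat 1)))"
proof -
  have "signal_phase \<phi> = mat 1 + (cis \<phi> - 1) *m outer (ket False) (ket False)"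
    by (simp add: vec_eq_iff signal_phase_def cscale_nth outer_nth axis_def mat_nth all_bool_eq)
  thus ?thesis
    by (auto simp: vec_eq_iff ket_tensor_mult_dagger mtensor_nth cscale_nth mat_nth prod_eq_iff
        algebra_simps)
qed

lemma ket_tensor_isometry: "dagger (ket_tensor b (mat 1)) ** ket_tensor b (mat 1) = mat 1"
  by (simp add: dagger_ket_tensor_mult)

lemma block_annihilates_fixed:
  fixes Y F Q :: "complex ^ 'n ^ 'n"
  assumes "dagger Y ** Y + dagger F ** F = mat 1" "Y ** Q = Q"
  shows "F ** Q = 0"
proof (rule dagger_mult_self_eq_0)
  have F: "dagger F ** F = mat 1 - dagger Y ** Y"
    using assms(1) by (simp add: algebra_simps)
  have "dagger (F ** Q) ** (F ** Q) = dagger Q ** (dagger F ** F) ** Q"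
    by (simp add: dagger_mult matrix_mul_assoc)
  also have "\<dots> = dagger Q ** Q - dagger (Y ** Q) ** (Y ** Q)"
    by (simp add: F matrix_diff_ldistrib matrix_diff_rdistrib dagger_mult matrix_mul_assoc)
  finally show "dagger (F ** Q) ** (F ** Q) = 0"
    by (simp add: assms(2))
qed

lemma approx_rot_error_eq:
  fixes U :: "complex ^ ('s \<times> 's) ^ ('s \<times> 's::finite)"
  assumes U: "unitary U" and C: "unitary C"
    and block: "C ** ket_tensor False (mat 1) = ket_tensor False Y + ket_tensor True F"
    and iso: "dagger Y ** Y + dagger F ** F = mat 1"
    and YQ: "Y ** Q = Q"
    and T: "U ** append_ket z = T" and QT: "Q ** T = T ** G"
  shows "approx_rot U C \<phi> ** signal_embed z - signal_embed z ** phase_rot \<phi> G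
    = (cis \<phi> - 1) *m ((mat 1 \<otimes>m dagger U) ** (dagger C ** (ket_tensor False (mat 1) ** ((Y - Q) ** T))))"
proof -
  let ?K0 = "ket_tensor False (mat 1) :: complex ^ ('s \<times> 's) ^ (bool \<times> 's \<times> 's)"
  let ?K1 = "ket_tensor True (mat 1) :: complex ^ ('s \<times> 's) ^ (bool \<times> 's \<times> 's)"
  let ?c = "cis \<phi> - 1" and ?V = "mat 1 \<otimes>m dagger U :: complex ^ (bool \<times> 's \<times> 's) ^ (bool \<times> 's \<times> 's)"
  have CC: "dagger C ** C = mat 1"
    using C by (simp add: unitary_def)
  have CK: "C ** ?K0 = ?K0 ** Y + ?K1 ** F"
    using block ket_tensor_eq[of False Y] ket_tensor_eq[of True F] by simp
  have "C ** (?K0 ** Q) = ?K0 ** (Y ** Q) + ?K1 ** (F ** Q)"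
    by (simp add: matrix_mul_assoc CK matrix_add_rdistrib)
  hence CKQ: "C ** (?K0 ** Q) = ?K0 ** Q"
    by (simp add: YQ block_annihilates_fixed[OF iso YQ])
  have "dagger C ** (C ** (?K0 ** Q)) = ?K0 ** Q"
    by (simp add: matrix_mul_assoc CC)
  hence fixed: "dagger C ** (?K0 ** Q) = ?K0 ** Q"
    by (simp only: CKQ)
  have "dagger ?K0 ** (C ** ?K0) = Y"
    unfolding CK by (simp add: matrix_add_ldistrib matrix_mul_assoc dagger_ket_tensor_mult)
  hence S: "dagger C ** (signal_phase \<phi> \<otimes>m mat 1) ** C ** ?K0 = ?K0 + ?c *m (dagger C ** (?K0 ** Y))"
    by (simp add: signal_phase_mtensor matrix_add_ldistrib matrix_add_rdistrib cscale_mult_left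
        cscale_mult_right CC flip: matrix_mul_assoc)
  have UJ: "(mat 1 \<otimes>m U) ** signal_embed z = ?K0 ** T"
    unfolding T [symmetric] signal_embed_eq by (simp add: matrix_mul_assoc mtensor_mult_ket_tensor)
  have "approx_rot U C \<phi> ** signal_embed z
      = ?V ** ((dagger C ** (signal_phase \<phi> \<otimes>m mat 1) ** C) ** ((mat 1 \<otimes>m U) ** signal_embed z))"
    by (simp add: approx_rot_def matrix_mul_assoc)
  also have "\<dots> = ?V ** ((dagger C ** (signal_phase \<phi> \<otimes>m mat 1) ** C ** ?K0) ** T)"
    by (simp add: UJ matrix_mul_assoc)
  also have "\<dots> = ?V ** (?K0 ** T + ?c *m (dagger C ** (?K0 ** (Y ** T))))"
    by (simp only: S matrix_add_rdistrib cscale_mult_left matrix_mul_assoc)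
  finally have 1: "approx_rot U C \<phi> ** signal_embed z
      = ?V ** (?K0 ** T + ?c *m (dagger C ** (?K0 ** (Y ** T))))" .
  have "?V ** (?K0 ** T) = ?K0 ** (dagger U ** U ** append_ket z)"
    unfolding T [symmetric] by (simp add: matrix_mul_assoc mtensor_mult_ket_tensor)
  hence "signal_embed z = ?V ** (?K0 ** T)"
    using U by (simp add: signal_embed_eq unitary_def)
  hence "signal_embed z ** phase_rot \<phi> G = ?V ** (?K0 ** (T + ?c *m (T ** G)))"
    by (simp add: phase_rot_def matrix_add_ldistrib cscale_mult_right matrix_mul_assoc)
  also have "\<dots> = ?V ** (?K0 ** T + ?c *m (?K0 ** Q ** T))"
    by (simp only: QT [symmetric] matrix_add_ldistrib cscale_mult_right matrix_mul_assoc)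
  also have "\<dots> = ?V ** (?K0 ** T + ?c *m (dagger C ** (?K0 ** (Q ** T))))"
    by (subst fixed [symmetric]) (simp only: matrix_mul_assoc)
  finally show ?thesis
    unfolding 1
    by (simp only: matrix_diff_ldistrib matrix_diff_rdistrib matrix_add_ldistrib cscale_mult_right
        cscale_diff add_diff_cancel_left)
qed

theorem mainTheorem3:
  fixes P :: "real ^ 's ^ 's" and \<pi> :: "real ^ 's"
    and z :: "'s::finite" and U :: "complex ^ ('s \<times> 's) ^ ('s \<times> 's)"
    and \<Delta> \<epsilon> \<phi> :: real and \<Pi>\<^sub>0 :: "complex ^ ('s \<times> 's) ^ ('s \<times> 's)"
    and d :: nat and R :: "nat \<Rightarrow> complex ^ bool ^ bool" and \<Upsilon> \<Phi> :: "complex poly"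
  assumes "stochastic P" and "ergodic P" and "stationary P \<pi>" and "reversible P \<pi>"
    and "is_oracle P z U"
    and "\<Delta> = phase_gap (walk P)"
    and "is_orth_proj_onto \<Pi>\<^sub>0 {v. (walk P - mat 1) *v v = 0}"
    and "0 < \<epsilon>" and "\<epsilon> < 1"
    and "projector_circuit (walk P) \<epsilon> d R \<Upsilon> \<Phi>"
  shows "op_norm (approx_rot U (gqsp (walk P) R d) \<phi> ** signal_embed z
            - signal_embed z ** phase_rot \<phi> (outer (stat_ket \<pi>) (stat_ket \<pi>))) \<le> 2 * \<epsilon>
       \<and> circuit_op U z (approx_rot_circuit R d \<phi>) = approx_rot U (gqsp (walk P) R d) \<phi>
       \<and> query_count (approx_rot_circuit R d \<phi>) = 4 * d + 2
       \<and> signal_qubits (approx_rot_circuit R d \<phi>) = 1"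
proof (intro conjI)
  note chain = assms(1-4)
  let ?W = "walk P" and ?T = "step_iso P" and ?C = "gqsp (walk P) R d"
  let ?K0 = "ket_tensor False (mat 1) :: complex ^ ('s \<times> 's) ^ (bool \<times> 's \<times> 's)"
  let ?Y = "mat_poly \<Upsilon> ?W" and ?F = "mat_poly \<Phi> ?W"
  have W: "unitary ?W"
    by (rule unitary_walk[OF assms(1)])
  have U: "unitary U"
    using assms(5) by (simp add: is_oracle_def)
  note pc = assms(10)[unfolded projector_circuit_def]
  have C: "unitary ?C"
    using pc by (intro unitary_gqsp W) auto
  have YQ: "?Y ** \<Pi>\<^sub>0 = \<Pi>\<^sub>0"
    using pc by (intro mat_poly_mult_fixed orth_proj_onto_kernel[OF W assms(7)]) auto
  have err: "approx_rot U ?C \<phi> ** signal_embed z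
        - signal_embed z ** phase_rot \<phi> (outer (stat_ket \<pi>) (stat_ket \<pi>))
      = (cis \<phi> - 1) *m ((mat 1 \<otimes>m dagger U) ** (dagger ?C ** (?K0 ** ((?Y - \<Pi>\<^sub>0) ** ?T))))"
    using pc by (intro approx_rot_error_eq[OF U C _ _ YQ oracle_append_ket[OF assms(5)]
          kernel_projector_step_iso[OF chain assms(7)]]) auto
  define c where "c = cis \<phi> - 1"
  have "norm ((c *m ((mat 1 \<otimes>m dagger U) ** (dagger ?C ** (?K0 ** ((?Y - \<Pi>\<^sub>0) ** ?T))))) *v v)
      \<le> 2 * \<epsilon> * norm v" for v
  proof -
    have V: "norm ((mat 1 \<otimes>m dagger U) *v x) = norm x" for x :: "complex ^ (bool \<times> 's \<times> 's)"
      using U by (intro norm_isometry) (simp add: dagger_mtensor mtensor_mult unitary_def)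
    have C': "norm (dagger ?C *v x) = norm x" for x
      using C by (intro norm_isometry) (simp add: unitary_def)
    have "norm ((?Y - \<Pi>\<^sub>0) *v (?T *v v)) \<le> \<epsilon> * norm (?T *v v)"
      using pc assms(8) by (intro mat_poly_minus_projector_norm[OF W assms(7)]) auto
    hence "norm ((?Y - \<Pi>\<^sub>0) *v (?T *v v)) \<le> \<epsilon> * norm v"
      by (simp add: norm_isometry dagger_step_iso_mult[OF assms(1)])
    moreover have "cmod c \<le> 2"
      using norm_triangle_ineq4[of "cis \<phi>" 1] by (simp add: c_def)
    ultimately have "cmod c * norm ((?Y - \<Pi>\<^sub>0) *v (?T *v v)) \<le> 2 * (\<epsilon> * norm v)"
      by (intro mult_mono) auto
    thus ?thesis
      by (simp add: cscale_mult_vec norm_cmult_vec V C' norm_isometry ket_tensor_isometry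
          flip: matrix_vector_mul_assoc)
  qed
  thus "op_norm (approx_rot U ?C \<phi> ** signal_embed z
      - signal_embed z ** phase_rot \<phi> (outer (stat_ket \<pi>) (stat_ket \<pi>))) \<le> 2 * \<epsilon>"
    unfolding op_norm_def err c_def by (rule onorm_le)
qed (use circuit_op_approx_rot[OF assms(5)] query_count_approx_rot signal_qubits_approx_rot in auto)

end
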